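(* Let $X$ be a separable Fréchet space and let $X_0$ be a dense linear subspace of $X$. For $1\le j\le N$ let $T_j:D(T_j)\subseteq X\to X$ be a closed linear operator on $X$, and let $C\in L(X)$ be an injective mapping such that $R(C)\subseteq D_\infty(T_j)$ and $T_j^kC\in L(X)$ for all $k\in\mathbb N$ and $1\le j\le N$. Suppose that: (a) $\lim_{k\to\infty}T_j^kCx=0$ for all $x\in X_0$ and $1\le j\le N$; (b) there exist $x\in X$, $m\in\mathbb N$ and a set $B\subseteq\mathbb N$ such that $\overline{dens}(B)=1$ and $\lim_{k\to\infty,\,k\in B}p_m(T_j^kCx)=\infty$ for all $1\le j\le N$, resp. $\lim_{k\to\infty,\,k\in B}\|T_j^kCx\|=\infty$ for all $1\le j\le N$ if $X$ is a Banach space. Then there exists a uniformly $(d,1)$-distributionally irregular manifold $W$ for the operators $T_1,\dots,T_N$, and in particular $T_1,\dots,T_N$ are $(d,1)$-distributionally chaotic. Furthermore, if $R(C)$ is dense in $X$, then $W$ can be chosen to be dense in $X$ and $T_1,\dots,T_N$ are densely $(d,1)$-distributionally chaotic.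
   Context: $X$ is a non-trivial Fréchet space over $\mathbb K\in\{\mathbb R,\mathbb C\}$ whose topology is induced by an increasing fundamental system of seminorms $(p_n)_{n\in\mathbb N}$, with $d(x,y)=\sum_{n\ge1}2^{-n}\frac{p_n(x-y)}{1+p_n(x-y)}$; if $X$ is a Banach space, $d(x,y)=\|x-y\|$ and $p_m$ is replaced by $\|\cdot\|$. $L(X)$ is the space of continuous linear operators on $X$, $R(C)$ is the range of $C$, and $D_\infty(T)=\bigcap_{n\in\mathbb N}D(T^n)$. $N\ge2$. For $D\subseteq\mathbb N$, $\overline{dens}(D)=\limsup_{n\to\infty}\frac{card(D\cap[1,n])}{n}$. A linear manifold (linear subspace) $\{0\}\ne W\subseteq X$ is a uniformly $(d,1)$-distributionally irregular manifold for $T_1,\dots,T_N$ iff there exists $m\in\mathbb N$ such that for every $x\in(W\cap\bigcap_{j=1}^ND_\infty(T_j))\setminus\{0\}$: there exists $A\subseteq\mathbb N$ with $\overline{dens}(A)=1$ and $\lim_{k\in A,k\to\infty}T_j^kx=0$ for all $1\le j\le N$, and there exists $B\subseteq\mathbb N$ with $\overline{dens}(B)=1$ and $\lim_{k\in B,k\to\infty}p_m(T_j^kx)=\infty$ for all $1\le j\le N$. $T_1,\dots,T_N$ are $(d,1)$-distributionally chaotic iff there exist an uncountable set $S\subseteq\bigcap_{j=1}^ND_\infty(T_j)$ and $\sigma>0$ such that for each $\epsilon>0$ and each pair $x,y\in S$ of distinct points, $\overline{dens}\big(\bigcap_{1\le j\le N}\{k:d(T_j^kx,T_j^ky)\ge\sigma\}\big)=1$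 and $\overline{dens}\big(\bigcap_{1\le j\le N}\{k:d(T_j^kx,T_j^ky)<\epsilon\}\big)=1$; densely so iff $S$ can be chosen dense in $X$. *)

theory Defs
  imports "HOL-Analysis.Analysis"
begin

text \<open>The scalar field is \<open>\<real>\<close> or \<open>\<complex>\<close>: either every element is the image of a real number, or the
  field is generated over the reals by a square root of \<open>-1\<close>.\<close>

class real_or_complex_field = real_normed_field +
  assumes real_or_complex:
    "(\<forall>z. \<exists>a. z = scaleR a 1) \<or>
     (\<exists>i. i * i = - 1 \<and> (\<forall>z. \<exists>a b. z = scaleR a 1 + scaleR b i))"

instance real :: real_or_complex_field
  by standard auto

instance complex :: real_or_complex_field
proof
  have "\<forall>z. \<exists>a b. z = scaleR a 1 + scaleR b \<i>"
    by (metis complex_eq mult.commute scaleR_conv_of_real mult.right_neutral)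
  then show "(\<forall>z::complex. \<exists>a. z = scaleR a 1) \<or>
     (\<exists>i::complex. i * i = - 1 \<and> (\<forall>z. \<exists>a b. z = scaleR a 1 + scaleR b i))"
    by (intro disjI2 exI[of _ \<i>]) simp
qed

definition seminorm :: "('k::real_normed_field \<Rightarrow> 'a::ab_group_add \<Rightarrow> 'a) \<Rightarrow> ('a \<Rightarrow> real) \<Rightarrow> bool" where
  "seminorm smul q \<longleftrightarrow>
     (\<forall>x y. q (x + y) \<le> q x + q y) \<and> (\<forall>a x. q (smul a x) = norm a * q x)"

text \<open>The whole type carries the space. The seminorms are indexed from 0, so that \<open>p n\<close> stands for
  the seminorm usually written with index \<open>n + 1\<close>.\<close>

locale frechet_space = vector_space smul
  for smul :: "'k::real_or_complex_field \<Rightarrow> 'a::{ab_group_add, topological_space} \<Rightarrow> 'a" +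
  fixes p :: "nat \<Rightarrow> 'a \<Rightarrow> real"
  assumes seminorms: "seminorm smul (p n)"
    and increasing: "incseq p"
    and separating: "(\<And>n. p n x = 0) \<Longrightarrow> x = 0"
    and open_iff: "open U \<longleftrightarrow> (\<forall>x\<in>U. \<exists>n. \<exists>e>0. \<forall>y. p n (y - x) < e \<longrightarrow> y \<in> U)"
    and Cauchy_converges:
      "(\<And>n e. e > 0 \<Longrightarrow> \<exists>M. \<forall>i\<ge>M. \<forall>j\<ge>M. p n (f i - f j) < e) \<Longrightarrow> \<exists>l. f \<longlonglongrightarrow> l"

text \<open>The convention for the metric: either the usual metric given by the seminorms or,
  for a Banach space, the metric of the norm, which then also takes the place of every seminorm.
  Together with \<open>frechet_space smul p\<close>, the second alternative says that
  \<open>nrm\<close> is a complete norm inducing the topology.\<close>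

definition standard_metric :: "(nat \<Rightarrow> 'a \<Rightarrow> real) \<Rightarrow> ('a::ab_group_add \<Rightarrow> 'a \<Rightarrow> real) \<Rightarrow> bool" where
  "standard_metric p d \<longleftrightarrow>
     d = (\<lambda>x y. \<Sum>n. (1/2) ^ Suc n * (p n (x - y) / (1 + p n (x - y)))) \<or>
     (\<exists>nrm. p = (\<lambda>_. nrm) \<and> d = (\<lambda>x y. nrm (x - y)))"

definition continuous_linear_operator ::
  "('k::field \<Rightarrow> 'a::{ab_group_add, topological_space} \<Rightarrow> 'a) \<Rightarrow> ('a \<Rightarrow> 'a) \<Rightarrow> bool" where
  "continuous_linear_operator smul A \<longleftrightarrow>
     Vector_Spaces.linear smul smul A \<and> continuous_on UNIV A"

text \<open>A partial operator is a domain \<open>D\<close> together with a total function, whose values outside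
  \<open>D\<close> are irrelevant.\<close>

definition closed_linear_operator ::
  "('k::field \<Rightarrow> 'a::{ab_group_add, topological_space} \<Rightarrow> 'a) \<Rightarrow> 'a set \<Rightarrow> ('a \<Rightarrow> 'a) \<Rightarrow> bool" where
  "closed_linear_operator smul D T \<longleftrightarrow>
     module.subspace smul D \<and>
     (\<forall>x\<in>D. \<forall>y\<in>D. T (x + y) = T x + T y) \<and>
     (\<forall>a. \<forall>x\<in>D. T (smul a x) = smul a (T x)) \<and>
     closed ((\<lambda>x. (x, T x)) ` D)"

text \<open>On \<open>dom_power D T n\<close>, the domain of the \<open>n\<close>-th power, the iterate \<open>T ^^ n\<close> only evaluates
  \<open>T\<close> at points of \<open>D\<close> and is therefore the power of the partial operator.\<close>

primrec dom_power :: "'a set \<Rightarrow> ('a \<Rightarrow> 'a) \<Rightarrow> nat \<Rightarrow> 'a set" where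
  "dom_power D T 0 = UNIV"
| "dom_power D T (Suc n) = {x \<in> dom_power D T n. (T ^^ n) x \<in> D}"

definition D_infinity :: "'a set \<Rightarrow> ('a \<Rightarrow> 'a) \<Rightarrow> 'a set" where
  "D_infinity D T = (\<Inter>n. dom_power D T n)"

definition upper_density :: "nat set \<Rightarrow> ereal" where
  "upper_density A = limsup (\<lambda>n. ereal (real (card (A \<inter> {1..n})) / real n))"

abbreviation along :: "nat set \<Rightarrow> nat filter" where
  "along A \<equiv> inf sequentially (principal A)"

definition uniformly_irregular_manifold ::
  "('k::field \<Rightarrow> 'a::{ab_group_add, topological_space} \<Rightarrow> 'a) \<Rightarrow> (nat \<Rightarrow> 'a \<Rightarrow> real) \<Rightarrow>
   nat \<Rightarrow> (nat \<Rightarrow> 'a set) \<Rightarrow> (nat \<Rightarrow> 'a \<Rightarrow> 'a) \<Rightarrow> 'a set \<Rightarrow> bool" where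
  "uniformly_irregular_manifold smul p N D T W \<longleftrightarrow>
     module.subspace smul W \<and> W \<noteq> {0} \<and>
     (\<exists>m. \<forall>x \<in> (W \<inter> (\<Inter>j\<in>{1..N}. D_infinity (D j) (T j))) - {0}.
        (\<exists>A. upper_density A = 1 \<and>
           (\<forall>j\<in>{1..N}. ((\<lambda>k. (T j ^^ k) x) \<longlongrightarrow> 0) (along A))) \<and>
        (\<exists>B. upper_density B = 1 \<and>
           (\<forall>j\<in>{1..N}. filterlim (\<lambda>k. p m ((T j ^^ k) x)) at_top (along B))))"

definition distributionally_scrambled ::
  "('a \<Rightarrow> 'a \<Rightarrow> real) \<Rightarrow> nat \<Rightarrow> (nat \<Rightarrow> 'a set) \<Rightarrow> (nat \<Rightarrow> 'a \<Rightarrow> 'a) \<Rightarrow> 'a set \<Rightarrow> bool" where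
  "distributionally_scrambled d N D T S \<longleftrightarrow>
     uncountable S \<and> S \<subseteq> (\<Inter>j\<in>{1..N}. D_infinity (D j) (T j)) \<and>
     (\<exists>\<sigma>>0. \<forall>\<epsilon>>0. \<forall>x\<in>S. \<forall>y\<in>S. x \<noteq> y \<longrightarrow>
        upper_density (\<Inter>j\<in>{1..N}. {k. d ((T j ^^ k) x) ((T j ^^ k) y) \<ge> \<sigma>}) = 1 \<and>
        upper_density (\<Inter>j\<in>{1..N}. {k. d ((T j ^^ k) x) ((T j ^^ k) y) < \<epsilon>}) = 1)"

definition distributionally_chaotic ::
  "('a \<Rightarrow> 'a \<Rightarrow> real) \<Rightarrow> nat \<Rightarrow> (nat \<Rightarrow> 'a set) \<Rightarrow> (nat \<Rightarrow> 'a \<Rightarrow> 'a) \<Rightarrow> bool" where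
  "distributionally_chaotic d N D T \<longleftrightarrow> (\<exists>S. distributionally_scrambled d N D T S)"

definition densely_distributionally_chaotic ::
  "('a::topological_space \<Rightarrow> 'a \<Rightarrow> real) \<Rightarrow> nat \<Rightarrow> (nat \<Rightarrow> 'a set) \<Rightarrow> (nat \<Rightarrow> 'a \<Rightarrow> 'a) \<Rightarrow> bool" where
  "densely_distributionally_chaotic d N D T \<longleftrightarrow>
     (\<exists>S. distributionally_scrambled d N D T S \<and> closure S = UNIV)"

end

theory Submission
  imports Defs
begin

text \<open>Put \<open>S j k = T\<^sub>j\<^sup>k \<circ> C\<close>. These are everywhere defined continuous linear operators, and since \<open>C\<close>
  is injective and maps into the domains of all powers, it suffices to find a dense subspace \<open>V\<close>
  whose nonzero vectors have irregular orbits under the \<open>S j k\<close>: then \<open>W = C ` V\<close> is the manifold,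
  it is dense as soon as the range of \<open>C\<close> is, and \<open>W\<close> itself is a scrambled set.

  The subspace comes from a gliding hump. Scaling the vector with the unbounded orbit and
  approximating it from the dense subspace \<open>X0\<close> yields vectors \<open>x k \<in> X0\<close> that are as small as one
  likes, together with all their images up to any prescribed time, and whose images are
  nevertheless large on a finite block \<open>E k\<close> of times that fills almost all of an initial segment
  of the natural numbers. As \<open>x k \<in> X0\<close>, its orbit dies out, so that after \<open>E k\<close> one can wait for a
  long block \<open>G k\<close> on which \<open>x 0, \<dots>, x k\<close> all have tiny images; only then is \<open>x (k + 1)\<close> chosen, so
  small that it is invisible up to the end of \<open>G k\<close> (\<open>ex_hump\<close>, \<open>ex_gliding_humps\<close>). Consequently a
  sum of the \<open>x l\<close> over any set of indices has small images on all blocks \<open>G k\<close>, and on \<open>E k\<close> its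
  images are, up to a small error, those of \<open>x k\<close> or \<open>0\<close>, depending on whether \<open>k\<close> is one of the
  indices.

  Splitting the indices into infinitely many infinite classes \<open>I n\<close> produces vectors \<open>w n\<close> that
  vanish along the common set formed by the blocks \<open>G k\<close>, while along the union of the \<open>E k\<close> with
  \<open>k \<in> I n\<close> the orbit of \<open>w n\<close> blows up and all other \<open>w n'\<close> vanish (\<open>irregular_family\<close>). Both
  properties survive when each \<open>w n\<close> is multiplied by a small nonzero scalar and an element of \<open>X0\<close>
  is added, which makes the family dense (\<open>dense_irregular_family\<close>). In a nonzero linear combination
  one coefficient, say the \<open>n\<close>-th, is nonzero, and along the \<open>n\<close>-th set the \<open>n\<close>-th term dominates
  (\<open>dense_irregular_subspace\<close>).\<close>

section \<open>Sets of upper density one\<close>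

text \<open>The quotients in the definition never exceed \<open>1\<close>, so upper density one only says that
  arbitrarily long initial segments are filled except for a small proportion. The later density
  arguments use this form.\<close>

lemma upper_density_eq_1_iff:
  "upper_density A = 1 \<longleftrightarrow>
     (\<forall>e>0. \<forall>M. \<exists>n\<ge>M. n > 0 \<and> (1 - e) * real n \<le> real (card (A \<inter> {1..n})))"
proof -
  define f where "f n = real (card (A \<inter> {1..n})) / real n" for n
  have "card (A \<inter> {1..n}) \<le> n" for n
    using card_mono[of "{1..n}" "A \<inter> {1..n}"] by simp
  then have f_le: "f n \<le> 1" for n
    by (auto simp: f_def divide_simps)
  have dens: "upper_density A = limsup (\<lambda>n. ereal (f n))"
    by (simp add: upper_density_def f_def)
  have le_1: "upper_density A \<le> 1"
    unfolding dens by (rule Limsup_bounded) (simp add: f_le)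
  show ?thesis
  proof (intro iffI allI impI)
    fix e :: real and M :: nat
    assume A: "upper_density A = 1" and e: "e > 0"
    show "\<exists>n\<ge>M. n > 0 \<and> (1 - e) * real n \<le> real (card (A \<inter> {1..n}))"
    proof (rule ccontr)
      assume H: "\<not> ?thesis"
      have "ereal (f n) \<le> ereal (1 - e)" if "n \<ge> max M 1" for n
      proof -
        have "\<not> (1 - e) * real n \<le> real (card (A \<inter> {1..n}))" "n > 0"
          using H that by auto
        then show ?thesis by (simp add: f_def divide_simps mult.commute)
      qed
      then have "limsup (\<lambda>n. ereal (f n)) \<le> ereal (1 - e)"
        by (intro Limsup_bounded eventually_sequentiallyI[of "max M 1"]) simp
      then show False using A e by (simp add: dens one_ereal_def)
    qed
  next
    assume H: "\<forall>e>0. \<forall>M. \<exists>n\<ge>M. n > 0 \<and> (1 - e) * real n \<le> real (card (A \<inter> {1..n}))"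
    show "upper_density A = 1"
    proof (rule ccontr)
      assume "upper_density A \<noteq> 1"
      then have "upper_density A < ereal 1"
        using le_1 by (simp add: one_ereal_def)
      from ereal_dense2[OF this] obtain c where c: "upper_density A < ereal c" "c < 1"
        by auto
      then obtain M where M: "\<And>n. n \<ge> M \<Longrightarrow> f n < c"
        using Limsup_lessD[of sequentially "\<lambda>n. ereal (f n)" "ereal c"]
        unfolding dens eventually_sequentially by auto
      obtain n where "n \<ge> M" "n > 0" "(1 - (1 - c)) * real n \<le> real (card (A \<inter> {1..n}))"
        using H[rule_format, of "1 - c" M] c by auto
      with M[of n] show False
        by (auto simp: f_def divide_simps mult.commute)
    qed
  qed
qed

text \<open>Discarding the finitely many exceptional elements of \<open>A\<close> costs a bounded number of points,
  which is negligible in long initial segments.\<close>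

lemma upper_density_1_mono_along:
  assumes A: "upper_density A = 1" and Q: "eventually Q (along A)"
  shows "upper_density {k. Q k} = 1"
  unfolding upper_density_eq_1_iff
proof (intro allI impI)
  fix e :: real and M :: nat assume e: "e > 0"
  obtain n0 where n0: "\<And>k. k \<ge> n0 \<Longrightarrow> k \<in> A \<Longrightarrow> Q k"
    using Q unfolding eventually_inf_principal eventually_sequentially by auto
  obtain M' :: nat where M': "real M' \<ge> 2 * real n0 / e"
    using real_arch_simple by blast
  obtain n where n: "n \<ge> max M M'" "n > 0" "(1 - e/2) * real n \<le> real (card (A \<inter> {1..n}))"
    using A[unfolded upper_density_eq_1_iff, rule_format, of "e/2" "max M M'"] e by auto
  have "A \<inter> {1..n} \<subseteq> ({k. Q k} \<inter> {1..n}) \<union> {..<n0}"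
    using n0 by (auto simp: not_less[symmetric])
  then have "card (A \<inter> {1..n}) \<le> card (({k. Q k} \<inter> {1..n}) \<union> {..<n0})"
    by (intro card_mono) auto
  also have "\<dots> \<le> card ({k. Q k} \<inter> {1..n}) + n0"
    using card_Un_le[of "{k. Q k} \<inter> {1..n}" "{..<n0}"] by simp
  finally have "card (A \<inter> {1..n}) \<le> card ({k. Q k} \<inter> {1..n}) + n0" .
  moreover have "real n0 \<le> e / 2 * real n"
  proof -
    have "2 * real n0 / e \<le> real n" using M' n by linarith
    then show ?thesis using e by (simp add: field_simps)
  qed
  ultimately have "(1 - e) * real n \<le> real (card ({k. Q k} \<inter> {1..n}))"
    using n(3) by (simp add: algebra_simps)
  then show "\<exists>n\<ge>M. n > 0 \<and> (1 - e) * real n \<le> real (card ({k. Q k} \<inter> {1..n}))"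
    using n by auto
qed

lemma upper_density_UN_blocks:
  assumes "infinite I"
    and block: "\<And>k. k \<in> I \<Longrightarrow>
      \<exists>n>k. (1 - 1 / real (Suc k)) * real n \<le> real (card (E k \<inter> {1..n}))"
  shows "upper_density (\<Union>k\<in>I. E k) = 1"
  unfolding upper_density_eq_1_iff
proof (intro allI impI)
  fix e :: real and M :: nat assume e: "e > 0"
  obtain K where K: "1 / real (Suc K) < e"
    using e nat_approx_posE by blast
  obtain k where k: "k \<in> I" "k > max K M"
    using \<open>infinite I\<close> unfolding infinite_nat_iff_unbounded by blast
  obtain n where n: "n > k" "(1 - 1 / real (Suc k)) * real n \<le> real (card (E k \<inter> {1..n}))"
    using block k by blast
  have "1 / real (Suc k) \<le> 1 / real (Suc K)"
    using k by (simp add: frac_le)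
  then have "(1 - e) * real n \<le> (1 - 1 / real (Suc k)) * real n"
    using K by (intro mult_right_mono) auto
  also note n(2)
  also have "card (E k \<inter> {1..n}) \<le> card ((\<Union>k\<in>I. E k) \<inter> {1..n})"
    using k by (intro card_mono) auto
  finally show "\<exists>n\<ge>M. n > 0 \<and> (1 - e) * real n \<le> real (card ((\<Union>k\<in>I. E k) \<inter> {1..n}))"
    using n k by (intro exI[of _ n]) auto
qed

text \<open>Since the blocks are finite, the early ones are left behind by the filter, and a bound that
  improves with the number of the block turns into a limit along their union.\<close>

lemma eventually_along_UN_blocks:
  fixes E :: "nat \<Rightarrow> nat set"
  assumes fin: "\<And>k. finite (E k)"
    and Q: "\<And>k i. k \<in> I \<Longrightarrow> k \<ge> K \<Longrightarrow> i \<in> E k \<Longrightarrow> Q i"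
  shows "eventually Q (along (\<Union>k\<in>I. E k))"
proof -
  have "finite (\<Union>k<K. E k)" using fin by simp
  then obtain n where n: "\<forall>i\<in>(\<Union>k<K. E k). i < n"
    using finite_nat_set_iff_bounded by blast
  have "Q i" if "i \<ge> n" "k \<in> I" "i \<in> E k" for i k
  proof (cases "k < K")
    case True
    then have "i < n" using n that(3) by blast
    then show ?thesis using that(1) by simp
  qed (use Q that in auto)
  then show ?thesis
    unfolding eventually_inf_principal eventually_sequentially by auto
qed

section \<open>Frechet spaces in terms of seminorms\<close>

lemma sum_half_powers_le: "finite F \<Longrightarrow> (\<Sum>l\<in>F. (1/2) ^ l) \<le> (2 :: real)"
  using sum_le_suminf[of "\<lambda>l. (1/2) ^ l :: real" F] by (simp add: suminf_geometric)

lemma sum_half_powers_tail_le: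
  assumes "finite F" "\<And>l. l \<in> F \<Longrightarrow> i \<le> l"
  shows "(\<Sum>l\<in>F. (1/2) ^ l) \<le> 2 * (1/2 :: real) ^ i"
proof -
  have "(\<Sum>l\<in>F. (1/2) ^ l) = (\<Sum>l\<in>F. (1/2) ^ i * (1/2 :: real) ^ (l - i))"
    using assms by (intro sum.cong) (auto simp flip: power_add)
  also have "\<dots> = (1/2) ^ i * (\<Sum>l\<in>(\<lambda>l. l - i) ` F. (1/2) ^ l)"
    using inj_on_diff_nat[of F i] assms(2) by (simp add: sum.reindex sum_distrib_left)
  also have "\<dots> \<le> (1/2) ^ i * 2"
    using assms(1) by (intro mult_left_mono sum_half_powers_le) auto
  finally show ?thesis by simp
qed

context frechet_space
begin

lemma seminorm_triangle: "p n (x + y) \<le> p n x + p n y"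
  and seminorm_scale: "p n (smul a x) = norm a * p n x"
  using seminorms[of n] unfolding seminorm_def by auto

lemma seminorm_zero [simp]: "p n 0 = 0"
  using seminorm_scale[of n 0 0] by simp

lemma seminorm_minus [simp]: "p n (- x) = p n x"
  using seminorm_scale[of n "-1" x] by simp

lemma seminorm_nonneg [simp]: "0 \<le> p n x"
  using seminorm_triangle[of n x "- x"] by simp

lemma seminorm_diff_triangle: "p n (x - y) \<le> p n x + p n y"
  using seminorm_triangle[of n x "- y"] by simp

lemma seminorm_triangle_lower: "p n x - p n y \<le> p n (x + y)"
  using seminorm_triangle[of n "x + y" "- y"] by simp

lemma seminorm_sum: "p n (\<Sum>i\<in>F. f i) \<le> (\<Sum>i\<in>F. p n (f i))"
proof (induction F rule: infinite_finite_induct)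
  case (insert i F)
  then show ?case using seminorm_triangle[of n "f i" "sum f F"] by auto
qed auto

lemma seminorm_mono: "n \<le> n' \<Longrightarrow> p n x \<le> p n' x"
  using increasing by (simp add: incseq_def le_fun_def)

lemma open_seminorm_ball: "open {y. p n (y - x) < e}"
  unfolding open_iff
proof
  fix y assume y: "y \<in> {y. p n (y - x) < e}"
  have "z \<in> {y. p n (y - x) < e}" if "p n (z - y) < e - p n (y - x)" for z
    using that seminorm_triangle[of n "z - y" "y - x"] by simp
  then show "\<exists>n' e'. e' > 0 \<and> (\<forall>z. p n' (z - y) < e' \<longrightarrow> z \<in> {y. p n (y - x) < e})"
    using y by (intro exI[of _ n] exI[of _ "e - p n (y - x)"]) auto
qed

lemma tendsto_seminorm_iff:
  "(f \<longlongrightarrow> l) F \<longleftrightarrow> (\<forall>n. \<forall>e>0. eventually (\<lambda>i. p n (f i - l) < e) F)"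
proof (intro iffI allI impI)
  fix n e assume f: "(f \<longlongrightarrow> l) F" and e: "(e::real) > 0"
  show "eventually (\<lambda>i. p n (f i - l) < e) F"
    using topological_tendstoD[OF f open_seminorm_ball[of n l e]] e by simp
next
  assume H: "\<forall>n. \<forall>e>0. eventually (\<lambda>i. p n (f i - l) < e) F"
  show "(f \<longlongrightarrow> l) F"
  proof (rule topological_tendstoI)
    fix U assume "open U" "l \<in> U"
    then obtain n e where "e > 0" and sub: "\<forall>y. p n (y - l) < e \<longrightarrow> y \<in> U"
      unfolding open_iff by blast
    then show "eventually (\<lambda>i. f i \<in> U) F"
      using eventually_mono[OF H[rule_format, OF \<open>e > 0\<close>, of n]] by simp
  qed
qed

lemma tendsto_zero_seminorm_iff:
  "(f \<longlongrightarrow> 0) F \<longleftrightarrow> (\<forall>n. ((\<lambda>i. p n (f i)) \<longlongrightarrow> 0) F)"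
  by (auto simp: tendsto_seminorm_iff tendsto_iff)

lemma closure_seminorm_iff:
  "x \<in> closure A \<longleftrightarrow> (\<forall>n. \<forall>e>0. \<exists>y\<in>A. p n (y - x) < e)"
proof (intro iffI allI impI)
  fix n e assume x: "x \<in> closure A" and e: "(e::real) > 0"
  have "x \<in> {y. p n (y - x) < e} \<inter> closure A"
    using x e by simp
  then have "{y. p n (y - x) < e} \<inter> A \<noteq> {}"
    using open_Int_closure_eq_empty[OF open_seminorm_ball[of n x e], of A] by blast
  then show "\<exists>y\<in>A. p n (y - x) < e" by blast
next
  assume H: "\<forall>n. \<forall>e>0. \<exists>y\<in>A. p n (y - x) < e"
  show "x \<in> closure A"
  proof (rule ccontr)
    assume "x \<notin> closure A"
    then have "open (- closure A)" "x \<in> - closure A" by auto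
    then obtain n e where "e > 0" "\<forall>y. p n (y - x) < e \<longrightarrow> y \<in> - closure A"
      unfolding open_iff by blast
    then show False using H closure_subset by blast
  qed
qed

lemma continuous_linear_operatorD:
  assumes "continuous_linear_operator smul A"
  shows "A (x + y) = A x + A y" "A (smul a x) = smul a (A x)" "A 0 = 0" "A (x - y) = A x - A y"
    "A (\<Sum>i\<in>F. f i) = (\<Sum>i\<in>F. A (f i))"
proof -
  interpret module_hom smul smul A
    using assms by (simp add: continuous_linear_operator_def linear_iff_module_hom)
  show "A (x + y) = A x + A y" "A (smul a x) = smul a (A x)" "A 0 = 0" "A (x - y) = A x - A y"
    "A (\<Sum>i\<in>F. f i) = (\<Sum>i\<in>F. A (f i))"
    by (simp_all add: add scale diff sum)
qed

lemma continuous_linear_operator_bound: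
  assumes A: "continuous_linear_operator smul A" and e: "e > 0"
  shows "\<exists>q. \<exists>\<delta>>0. \<forall>x. p q x < \<delta> \<longrightarrow> p n (A x) < e"
proof -
  have "open (A -` {y. p n (y - 0) < e})"
    using A by (intro open_vimage open_seminorm_ball) (simp add: continuous_linear_operator_def)
  moreover have "0 \<in> A -` {y. p n (y - 0) < e}"
    using e by (simp add: continuous_linear_operatorD[OF A])
  ultimately show ?thesis
    unfolding open_iff by fastforce
qed

lemma finite_continuous_linear_operators_bound:
  assumes "finite \<A>" and "\<And>A. A \<in> \<A> \<Longrightarrow> continuous_linear_operator smul A" and e: "e > 0"
  shows "\<exists>q. \<exists>\<delta>>0. \<forall>x. p q x < \<delta> \<longrightarrow> (\<forall>A\<in>\<A>. p n (A x) < e)"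
  using assms(1,2)
proof (induction \<A>)
  case (insert A \<A>)
  obtain q \<delta> where q: "\<delta> > 0" "\<And>x. p q x < \<delta> \<Longrightarrow> \<forall>A\<in>\<A>. p n (A x) < e"
    using insert by blast
  obtain q' \<delta>' where q': "\<delta>' > 0" "\<And>x. p q' x < \<delta>' \<Longrightarrow> p n (A x) < e"
    using continuous_linear_operator_bound[OF insert.prems[of A] e] by blast
  have "p n (B x) < e" if "p (max q q') x < min \<delta> \<delta>'" "B \<in> insert A \<A>" for x B
    using q(2)[of x] q'(2)[of x] that seminorm_mono[of q "max q q'" x]
      seminorm_mono[of q' "max q q'" x] by auto
  then show ?case
    using q(1) q'(1) by (intro exI[of _ "max q q'"] exI[of _ "min \<delta> \<delta>'"]) auto
qed (auto intro: exI[of _ 1])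

lemma continuous_linear_operator_tendsto:
  assumes A: "continuous_linear_operator smul A" and f: "(f \<longlongrightarrow> l) F"
  shows "((\<lambda>i. A (f i)) \<longlongrightarrow> A l) F"
  using assms by (auto simp: continuous_linear_operator_def intro: continuous_on_tendsto_compose)

lemma seminorm_limit_le:
  assumes A: "continuous_linear_operator smul A" and f: "(f \<longlongrightarrow> l) F" and F: "F \<noteq> bot"
    and le: "eventually (\<lambda>i. p n (A (f i) - a) \<le> c) F"
  shows "p n (A l - a) \<le> c"
proof (rule field_le_epsilon)
  fix e :: real assume "e > 0"
  then have "eventually (\<lambda>i. p n (A (f i) - A l) < e) F"
    using continuous_linear_operator_tendsto[OF A f, unfolded tendsto_seminorm_iff] by simp
  with le have "eventually (\<lambda>i. p n (A l - a) \<le> c + e) F"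
  proof eventually_elim
    case (elim i)
    then show ?case
      using seminorm_diff_triangle[of n "A (f i) - a" "A (f i) - A l"] by simp
  qed
  then show "p n (A l - a) \<le> c + e" using F eventually_const by blast
qed

text \<open>For a fixed seminorm \<open>p n\<close> the bound is only available from the \<open>n\<close>-th term on; this is
  enough, since the seminorms increase and finitely many terms do not affect convergence.\<close>

lemma geometric_series_converges:
  fixes x :: "nat \<Rightarrow> 'a"
  assumes x: "\<And>n l. n \<le> l \<Longrightarrow> p n (x l) \<le> (1/2) ^ l"
  shows "\<exists>w. (\<lambda>K. \<Sum>l\<in>I \<inter> {..<K}. x l) \<longlonglongrightarrow> w"
proof (rule Cauchy_converges)
  let ?s = "\<lambda>K. \<Sum>l\<in>I \<inter> {..<K}. x l"
  have tail: "p n (?s j - ?s i) \<le> 2 * (1/2) ^ i" if "n \<le> i" "i \<le> j" for n i j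
  proof -
    have "?s j - ?s i = (\<Sum>l\<in>I \<inter> {..<j} - I \<inter> {..<i}. x l)"
      using that by (subst sum_diff) auto
    then have "p n (?s j - ?s i) \<le> (\<Sum>l\<in>I \<inter> {..<j} - I \<inter> {..<i}. p n (x l))"
      by (simp only: seminorm_sum)
    also have "\<dots> \<le> (\<Sum>l\<in>I \<inter> {..<j} - I \<inter> {..<i}. (1/2) ^ l)"
      using that by (intro sum_mono x) auto
    also have "\<dots> \<le> 2 * (1/2) ^ i"
      by (rule sum_half_powers_tail_le) auto
    finally show ?thesis .
  qed
  fix n and e :: real assume e: "e > 0"
  obtain k :: nat where k: "(1/2) ^ k < e / 2"
    using real_arch_pow_inv[of "e/2" "1/2"] e by auto
  have bound: "p n (?s j - ?s i) < e" if "max n k \<le> i" "i \<le> j" for i j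
  proof -
    have "(1/2 :: real) ^ i \<le> (1/2) ^ k"
      using that by (intro power_decreasing) auto
    then show ?thesis using tail[of n i j] that k by linarith
  qed
  have "p n (?s i - ?s j) < e" if "max n k \<le> i" "max n k \<le> j" for i j
    using bound[of i j] bound[of j i] that seminorm_minus[of n "?s i - ?s j"]
    by (cases "i \<le> j") auto
  then show "\<exists>M. \<forall>i\<ge>M. \<forall>j\<ge>M. p n (?s i - ?s j) < e" by blast
qed

text \<open>The terms with index in \<open>Q\<close> are exempt from the bound and subtracted: for \<open>Q = {}\<close> this
  bounds the image of the whole sum, and for \<open>Q = {k}\<close> it says that the image of the sum is close to
  that of its \<open>k\<close>-th term.\<close>

lemma series_remove_terms_le:
  assumes A: "continuous_linear_operator smul A"
    and w: "(\<lambda>K. \<Sum>l\<in>I \<inter> {..<K}. x l) \<longlonglongrightarrow> w"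
    and Q: "finite Q"
    and small: "\<And>l. l \<notin> Q \<Longrightarrow> p n (A (x l)) \<le> c * (1/2) ^ l"
    and c: "c \<ge> 0"
  shows "p n (A w - (\<Sum>l\<in>I \<inter> Q. A (x l))) \<le> 2 * c"
proof (rule seminorm_limit_le[OF A w])
  obtain K0 where K0: "\<forall>l\<in>Q. l < K0"
    using Q finite_nat_set_iff_bounded by blast
  have "p n (A (\<Sum>l\<in>I \<inter> {..<K}. x l) - (\<Sum>l\<in>I \<inter> Q. A (x l))) \<le> 2 * c" if K: "K \<ge> K0" for K
  proof -
    have "A (\<Sum>l\<in>I \<inter> {..<K}. x l) - (\<Sum>l\<in>I \<inter> Q. A (x l))
        = (\<Sum>l\<in>I \<inter> {..<K} - I \<inter> Q. A (x l))"
      using K0 K by (subst sum_diff) (auto simp: continuous_linear_operatorD(5)[OF A])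
    also have "p n \<dots> \<le> (\<Sum>l\<in>I \<inter> {..<K} - I \<inter> Q. p n (A (x l)))"
      by (rule seminorm_sum)
    also have "\<dots> \<le> (\<Sum>l\<in>I \<inter> {..<K} - I \<inter> Q. c * (1/2) ^ l)"
      by (intro sum_mono small) auto
    also have "\<dots> = c * (\<Sum>l\<in>I \<inter> {..<K} - I \<inter> Q. (1/2) ^ l)"
      by (simp add: sum_distrib_left)
    also have "\<dots> \<le> c * 2"
      by (intro mult_left_mono sum_half_powers_le c) auto
    finally show ?thesis by simp
  qed
  then show "eventually (\<lambda>K. p n (A (\<Sum>l\<in>I \<inter> {..<K}. x l) - (\<Sum>l\<in>I \<inter> Q. A (x l))) \<le> 2 * c)
      sequentially"
    by (rule eventually_sequentiallyI)
qed simp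

lemma tendsto_zero_combination:
  assumes "\<And>n. n \<in> F \<Longrightarrow> (f n \<longlongrightarrow> 0) X"
  shows "((\<lambda>i. \<Sum>n\<in>F. smul (c n) (f n i)) \<longlongrightarrow> 0) X"
  unfolding tendsto_zero_seminorm_iff
proof
  fix r
  have null: "((\<lambda>i. \<Sum>n\<in>F. norm (c n) * p r (f n i)) \<longlongrightarrow> 0) X"
    using assms by (intro tendsto_null_sum tendsto_mult_right_zero)
      (auto simp: tendsto_zero_seminorm_iff)
  have "norm (p r (\<Sum>n\<in>F. smul (c n) (f n i))) \<le> (\<Sum>n\<in>F. norm (c n) * p r (f n i))" for i
    using seminorm_sum[of r "\<lambda>n. smul (c n) (f n i)" F] by (simp add: seminorm_scale)
  from Lim_null_comparison[OF always_eventually null, OF allI, OF this]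
  show "((\<lambda>i. p r (\<Sum>n\<in>F. smul (c n) (f n i))) \<longlongrightarrow> 0) X" .
qed

lemma tendsto_zero_add_scale:
  assumes "(f \<longlongrightarrow> 0) X" "(g \<longlongrightarrow> 0) X"
  shows "((\<lambda>i. f i + smul c (g i)) \<longlongrightarrow> 0) X"
proof -
  \<comment> \<open>a combination of the two families with coefficients \<open>1\<close> and \<open>c\<close>\<close>
  have "((\<lambda>i. \<Sum>n\<in>{0, 1 :: nat}. smul ([1, c] ! n) (([f, g] ! n) i)) \<longlongrightarrow> 0) X"
    using assms by (intro tendsto_zero_combination) auto
  then show ?thesis by simp
qed

lemma seminorm_at_top_add_null:
  assumes f: "filterlim (\<lambda>i. p n (f i)) at_top X" and g: "(g \<longlongrightarrow> 0) X" and c: "c \<noteq> 0"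
  shows "filterlim (\<lambda>i. p n (g i + smul c (f i))) at_top X"
proof (rule filterlim_at_top_mono)
  have "((\<lambda>i. - p n (g i)) \<longlongrightarrow> - 0) X"
    using g by (intro tendsto_minus) (auto simp: tendsto_zero_seminorm_iff)
  moreover have "filterlim (\<lambda>i. norm c * p n (f i)) at_top X"
    using c f by (intro filterlim_tendsto_pos_mult_at_top[OF tendsto_const]) auto
  ultimately show "filterlim (\<lambda>i. - p n (g i) + norm c * p n (f i)) at_top X"
    by (rule filterlim_tendsto_add_at_top)
  show "eventually (\<lambda>i. - p n (g i) + norm c * p n (f i) \<le> p n (g i + smul c (f i))) X"
    using seminorm_triangle_lower[of n "smul c (f _)" "g _"]
    by (intro always_eventually allI) (simp add: seminorm_scale add.commute)
qed

lemma small_multiple: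
  assumes "\<delta> > 0"
  shows "\<exists>t. t \<noteq> 0 \<and> p n (smul t x) < \<delta>"
proof (intro exI conjI)
  let ?r = "\<delta> / (1 + p n x)"
  have pos: "1 + p n x > 0"
    by (rule add_pos_nonneg) auto
  show "of_real ?r \<noteq> (0 :: 'k)"
    using assms pos by (simp only: of_real_eq_0_iff) simp
  show "p n (smul (of_real ?r) x) < \<delta>"
  proof -
    have "p n (smul (of_real ?r) x) = ?r * p n x"
      using assms pos by (simp only: seminorm_scale norm_of_real) simp
    also have "\<dots> < \<delta>"
      using assms pos by (simp add: field_simps)
    finally show ?thesis .
  qed
qed

lemma span_range_combination:
  assumes "x \<in> span (range v)" "x \<noteq> 0"
  obtains F c n where "finite F" "x = (\<Sum>l\<in>F. smul (c l) (v l))" "n \<in> F" "c n \<noteq> 0"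
proof -
  obtain t r where t: "finite t" "t \<subseteq> range v" "x = (\<Sum>a\<in>t. smul (r a) a)"
    using assms(1) unfolding span_explicit by blast
  then obtain F where F: "inj_on v F" "t = v ` F"
    by (metis subset_image_inj)
  then have "finite F" using t(1) finite_image_iff by blast
  moreover have x: "x = (\<Sum>l\<in>F. smul (r (v l)) (v l))"
    using t(3) F by (simp add: sum.reindex)
  moreover have "\<exists>n\<in>F. r (v n) \<noteq> 0"
  proof (rule ccontr)
    assume "\<not> (\<exists>n\<in>F. r (v n) \<noteq> 0)"
    then have "x = 0" by (subst x) (auto intro: sum.neutral)
    then show False using assms(2) by simp
  qed
  ultimately show ?thesis using that[of F "\<lambda>l. r (v l)"] by blast
qed

lemma separable_dense_sequence:
  assumes "separable_space (euclidean :: 'a topology)"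
  obtains u :: "nat \<Rightarrow> 'a" where "closure (range u) = UNIV"
proof -
  obtain Q :: "'a set" where Q: "countable Q" "closure Q = UNIV"
    using assms unfolding separable_space_def by auto
  then have "Q \<noteq> {}" by auto
  then show ?thesis
    using that[of "from_nat_into Q"] Q by (simp add: range_from_nat_into)
qed

text \<open>The real multiples of a nonzero vector are already uncountably many.\<close>

lemma uncountable_subspace:
  assumes "subspace W" "x \<in> W" "x \<noteq> 0"
  shows "uncountable W"
proof
  assume "countable W"
  moreover have "range (\<lambda>r::real. smul (of_real r) x) \<subseteq> W"
    using subspace_scale[OF assms(1,2)] by blast
  ultimately have "countable (range (\<lambda>r::real. smul (of_real r) x))"
    using countable_subset by blast
  moreover have "inj (\<lambda>r::real. smul (of_real r) x)"
    using assms(3) by (simp add: inj_def)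
  ultimately show False
    using countable_image_inj_on uncountable_UNIV_real by blast
qed

end

section \<open>The gliding hump\<close>

text \<open>\<open>S j i\<close> stands for the everywhere defined operator \<open>T\<^sub>j\<^sup>i \<circ> C\<close>, but the construction does not
  refer to powers of an operator. It applies to any finite number of sequences of operators whose
  orbits vanish on a dense subspace and for which one vector is unbounded simultaneously along a set
  of upper density one.\<close>

locale vanishing_unbounded_orbits = frechet_space smul p
  for smul :: "'k::real_or_complex_field \<Rightarrow> 'a::{ab_group_add, topological_space} \<Rightarrow> 'a"
    and p :: "nat \<Rightarrow> 'a \<Rightarrow> real" +
  fixes J :: "'j set" and S :: "'j \<Rightarrow> nat \<Rightarrow> 'a \<Rightarrow> 'a" and X0 :: "'a set"
    and x0 :: 'a and m :: nat and B :: "nat set"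
  assumes finite_J: "finite J"
    and S: "j \<in> J \<Longrightarrow> continuous_linear_operator smul (S j i)"
    and dense_X0: "closure X0 = UNIV"
    and vanishing: "x \<in> X0 \<Longrightarrow> j \<in> J \<Longrightarrow> (\<lambda>i. S j i x) \<longlonglongrightarrow> 0"
    and density_B: "upper_density B = 1"
    and unbounded: "j \<in> J \<Longrightarrow> filterlim (\<lambda>i. p m (S j i x0)) at_top (along B)"
begin

lemma uniform_continuity_upto:
  assumes e: "e > 0"
  shows "\<exists>q. \<exists>\<delta>>0. \<forall>x. p q x < \<delta> \<longrightarrow> p n x < e \<and> (\<forall>j\<in>J. \<forall>i\<le>K. p n (S j i x) < e)"
proof -
  let ?\<A> = "insert (\<lambda>x. x) ((\<lambda>(j, i). S j i) ` (J \<times> {..K}))"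
  have "continuous_linear_operator smul (\<lambda>x. x)"
    using linear_ident by (simp add: continuous_linear_operator_def)
  then have "\<exists>q. \<exists>\<delta>>0. \<forall>x. p q x < \<delta> \<longrightarrow> (\<forall>A\<in>?\<A>. p n (A x) < e)"
    by (intro finite_continuous_linear_operators_bound e) (auto simp: finite_J S)
  then show ?thesis by fastforce
qed

lemma uniformly_vanishing:
  assumes "finite F" "F \<subseteq> X0" and e: "e > 0"
  shows "\<exists>R. \<forall>i\<ge>R. \<forall>x\<in>F. \<forall>j\<in>J. p n (S j i x) < e"
proof -
  have "eventually (\<lambda>i. p n (S j i x) < e) sequentially" if "x \<in> F" "j \<in> J" for x j
    using vanishing[of x j] that assms(2) e unfolding tendsto_seminorm_iff by auto
  then have "eventually (\<lambda>i. \<forall>x\<in>F. \<forall>j\<in>J. p n (S j i x) < e) sequentially"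
    using assms(1) finite_J by (simp add: eventually_ball_finite)
  then show ?thesis by (simp add: eventually_sequentially)
qed

text \<open>The requirements on the \<open>k\<close>-th step of the construction, which may use the earlier vectors
  \<open>xs l\<close> with \<open>l < k\<close> and the time \<open>K\<close> at which the previous step ended. The new vector \<open>x\<close> is
  negligible up to time \<open>K\<close>; between \<open>K\<close> and the new final time \<open>L\<close> there is a block \<open>E\<close> on which
  only \<open>x\<close> is large, and a block \<open>G\<close> on which \<open>x\<close> and all earlier vectors are small. The tolerance
  \<open>(1/4) ^ k\<close> is at most \<open>(1/2) ^ k * (1/2) ^ l\<close> for \<open>l \<le> k\<close>, a bound that can be summed over \<open>l\<close>.\<close>

definition hump :: "(nat \<Rightarrow> 'a) \<Rightarrow> nat \<Rightarrow> nat \<Rightarrow> 'a \<Rightarrow> nat \<Rightarrow> nat set \<Rightarrow> nat set \<Rightarrow> bool" where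
  "hump xs k K x L E G \<longleftrightarrow>
     x \<in> X0 \<and> p k x \<le> (1/4) ^ k \<and> (\<forall>j\<in>J. \<forall>i\<le>K. p k (S j i x) \<le> (1/4) ^ k) \<and>
     K \<le> L \<and> E \<subseteq> {K..L} \<and> G \<subseteq> {K..L} \<and>
     (\<exists>n>k. (1 - 1 / real (Suc k)) * real n \<le> real (card (E \<inter> {1..n}))) \<and>
     (\<exists>n>k. (1 - 1 / real (Suc k)) * real n \<le> real (card (G \<inter> {1..n}))) \<and>
     (\<forall>i\<in>E. \<forall>j\<in>J. real k \<le> p m (S j i x)) \<and>
     (\<forall>i\<in>E. \<forall>j\<in>J. \<forall>l<k. p k (S j i (xs l)) \<le> (1/4) ^ k) \<and>
     (\<forall>i\<in>G. \<forall>j\<in>J. p k (S j i x) \<le> (1/4) ^ k) \<and>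
     (\<forall>i\<in>G. \<forall>j\<in>J. \<forall>l<k. p k (S j i (xs l)) \<le> (1/4) ^ k)"

text \<open>The vector is found in \<open>X0\<close> near a small multiple of \<open>x0\<close>. The order of the choices matters:
  first the scaling factor, as dictated by continuity up to time \<open>K\<close>; then the length \<open>n\<close> of the
  segment that contains the large block, which exists because scaling does not change unboundedness;
  then the approximation from \<open>X0\<close>, as fine as required by the operators up to time \<open>n\<close>; and finally
  the waiting time after which the orbit of the approximation has died out.\<close>

lemma ex_hump:
  assumes xs: "\<And>l. l < k \<Longrightarrow> xs l \<in> X0"
  shows "\<exists>x L E G. hump xs k K x L E G"
proof -
  let ?e = "(1/4) ^ k :: real"
  have fin: "finite (xs ` {..<k})" "xs ` {..<k} \<subseteq> X0" using xs by auto
  obtain R0 where "\<forall>i\<ge>R0. \<forall>x\<in>xs ` {..<k}. \<forall>j\<in>J. p k (S j i x) < ?e"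
    using uniformly_vanishing[OF fin, of ?e k] by auto
  define R where "R = max R0 K"
  have R: "p k (S j i (xs l)) \<le> ?e" if "i \<ge> R" "l < k" "j \<in> J" for i l j
    using \<open>\<forall>i\<ge>R0. _\<close> that by (auto simp: R_def intro: less_imp_le)
  obtain q \<delta> where \<delta>: "\<delta> > 0"
    and small: "\<And>x. p q x < \<delta> \<Longrightarrow> p k x < ?e \<and> (\<forall>j\<in>J. \<forall>i\<le>K. p k (S j i x) < ?e)"
    using uniform_continuity_upto[of ?e k K] by auto
  obtain t where t: "t \<noteq> 0" "p q (smul t x0) < \<delta> / 2"
    using small_multiple[of "\<delta> / 2" q x0] \<delta> by auto
  define big where "big i \<longleftrightarrow> i > R \<and> (\<forall>j\<in>J. real k + 1 \<le> p m (S j i (smul t x0)))" for i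
  have "eventually (\<lambda>i. real k + 1 \<le> p m (S j i (smul t x0))) (along B)" if "j \<in> J" for j
  proof -
    have "eventually (\<lambda>i. (real k + 1) / norm t \<le> p m (S j i x0)) (along B)"
      using unbounded[OF that] unfolding filterlim_at_top by blast
    then show ?thesis
      by eventually_elim
        (use t(1) in \<open>simp add: continuous_linear_operatorD(2)[OF S[OF that]] seminorm_scale
          field_simps\<close>)
  qed
  moreover have "eventually (\<lambda>i. i > R) (along B)"
    unfolding eventually_inf_principal
    by (rule eventually_mono[OF eventually_gt_at_top[of R]]) simp
  ultimately have "eventually big (along B)"
    unfolding big_def using finite_J by (simp add: eventually_ball_finite eventually_conj)
  then have "upper_density {i. big i} = 1"
    using upper_density_1_mono_along[OF density_B] by blast
  then obtain n where n: "n > k"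
    "(1 - 1 / real (Suc k)) * real n \<le> real (card ({i. big i} \<inter> {1..n}))"
    unfolding upper_density_eq_1_iff
    by (metis Suc_le_eq of_nat_0_less_iff zero_less_Suc zero_less_divide_1_iff)
  define E where "E = {i. big i} \<inter> {1..n}"
  obtain q' \<delta>' where \<delta>': "\<delta>' > 0"
    and close: "\<And>x. p q' x < \<delta>' \<Longrightarrow> p m x < 1 \<and> (\<forall>j\<in>J. \<forall>i\<le>n. p m (S j i x) < 1)"
    using uniform_continuity_upto[of 1 m n] by auto
  obtain x where x: "x \<in> X0" "p (max q q') (x - smul t x0) < min (\<delta> / 2) \<delta>'"
    using dense_X0 \<delta> \<delta>' closure_seminorm_iff[of "smul t x0" X0]
    by (metis UNIV_I half_gt_zero min_less_iff_conj)
  have xq: "p q (x - smul t x0) < \<delta> / 2" "p q' (x - smul t x0) < \<delta>'"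
    using x(2) seminorm_mono[of q "max q q'" "x - smul t x0"]
      seminorm_mono[of q' "max q q'" "x - smul t x0"] by auto
  have "p q x < \<delta>"
    using seminorm_triangle[of q "x - smul t x0" "smul t x0"] xq(1) t(2) by simp
  note x_small = small[OF this]
  have x_big: "real k \<le> p m (S j i x)" if "i \<in> E" "j \<in> J" for i j
  proof -
    have "p m (S j i (smul t x0)) \<le> p m (S j i x) + p m (S j i (x - smul t x0))"
      using seminorm_diff_triangle[of m "S j i x" "S j i (x - smul t x0)"]
      by (simp add: continuous_linear_operatorD(4)[OF S[OF that(2)]])
    then show ?thesis
      using that close[OF xq(2)] by (fastforce simp: E_def big_def)
  qed
  obtain R1 where R1: "\<forall>i\<ge>R1. \<forall>x\<in>{x}. \<forall>j\<in>J. p k (S j i x) < ?e"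
    using uniformly_vanishing[of "{x}" ?e k] x by auto
  \<comment> \<open>the final time exceeds the waiting time \<open>R'\<close> by a factor of \<open>k + 1\<close>, so that the times after
    \<open>R'\<close> make up a proportion of at least \<open>1 - 1 / (k + 1)\<close>\<close>
  define R' where "R' = max R1 (max R n)"
  define L where "L = Suc k * Suc R'"
  define G where "G = {R'<..L}"
  have "R' \<le> L" by (simp add: L_def)
  have "G \<inter> {1..L} = G" by (auto simp: G_def)
  then have "real (card (G \<inter> {1..L})) = real L - real R'"
    using \<open>R' \<le> L\<close> by (simp add: G_def)
  moreover have "real L = real (Suc k) * real (Suc R')"
    by (simp only: L_def of_nat_mult)
  then have "1 / real (Suc k) * real L = real (Suc R')"
    by (simp del: of_nat_Suc)
  ultimately have G: "(1 - 1 / real (Suc k)) * real L \<le> real (card (G \<inter> {1..L}))"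
    by (simp add: left_diff_distrib)
  have "hump xs k K x L E G"
    unfolding hump_def
  proof (intro conjI ballI allI impI)
    show "E \<subseteq> {K..L}" "G \<subseteq> {K..L}" "K \<le> L"
      using \<open>R' \<le> L\<close> by (auto simp: E_def G_def big_def R'_def R_def)
    show "\<exists>n>k. (1 - 1 / real (Suc k)) * real n \<le> real (card (E \<inter> {1..n}))"
      using n by (intro exI[of _ n]) (simp add: E_def Int_assoc)
    show "\<exists>n>k. (1 - 1 / real (Suc k)) * real n \<le> real (card (G \<inter> {1..n}))"
      using G by (intro exI[of _ L]) (simp add: L_def)
  qed (use x(1) x_small x_big R R1 in
      \<open>auto simp: E_def G_def big_def R'_def less_imp_le\<close>)
  then show ?thesis by blast
qed

text \<open>The choice of each step refers to all earlier vectors, hence the well-founded form of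
  dependent choice.\<close>

lemma ex_gliding_humps:
  "\<exists>x L E G. \<forall>k. hump x k (if k = 0 then 0 else L (k - 1)) (x k) (L k) (E k) (G k)"
proof -
  define P :: "(nat \<Rightarrow> 'a \<times> nat \<times> nat set \<times> nat set) \<Rightarrow> nat \<Rightarrow>
      'a \<times> nat \<times> nat set \<times> nat set \<Rightarrow> bool"
    where "P f k r \<longleftrightarrow>
    hump (fst \<circ> f) k (if k = 0 then 0 else fst (snd (f (k - 1)))) (fst r) (fst (snd r))
      (fst (snd (snd r))) (snd (snd (snd r)))" for f k r
  have "\<exists>f. \<forall>k. P f k (f k)"
  proof (rule dependent_wf_choice[OF wf_less_than])
    fix f g :: "nat \<Rightarrow> 'a \<times> nat \<times> nat set \<times> nat set" and k r
    assume "\<And>l. (l, k) \<in> less_than \<Longrightarrow> f l = g l"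
    then show "P f k r = P g k r"
      by (auto simp: P_def hump_def)
  next
    fix k and f :: "nat \<Rightarrow> 'a \<times> nat \<times> nat set \<times> nat set"
    assume "\<And>l. (l, k) \<in> less_than \<Longrightarrow> P f l (f l)"
    then have "(fst \<circ> f) l \<in> X0" if "l < k" for l
      using that by (auto simp: P_def hump_def)
    then have "\<exists>x L E G. hump (fst \<circ> f) k (if k = 0 then 0 else fst (snd (f (k - 1)))) x L E G"
      by (rule ex_hump)
    then show "\<exists>r. P f k r"
      by (simp add: P_def)
  qed
  then obtain f where f: "\<And>k. P f k (f k)" by blast
  show ?thesis
    by (intro exI[of _ "fst \<circ> f"] exI[of _ "\<lambda>k. fst (snd (f k))"]
        exI[of _ "\<lambda>k. fst (snd (snd (f k)))"] exI[of _ "\<lambda>k. snd (snd (snd (f k)))"])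
      (use f in \<open>simp add: P_def comp_def\<close>)
qed

text \<open>On the blocks of the \<open>k\<close>-th step, the images of all \<open>x l\<close> (on \<open>E k\<close>: with \<open>l \<noteq> k\<close>) are at most
  \<open>(1/2) ^ k * (1/2) ^ l\<close>: for earlier indices this is required of the blocks, for later indices it
  holds because those vectors are negligible until their own step begins. Summation over any set of
  indices therefore leaves an error of at most \<open>2 * (1/2) ^ k\<close>.\<close>

lemma irregular_family:
  obtains w :: "nat \<Rightarrow> 'a" and A and H :: "nat \<Rightarrow> nat set" where
    "upper_density A = 1" "\<And>n. upper_density (H n) = 1"
    "\<And>n j. j \<in> J \<Longrightarrow> ((\<lambda>i. S j i (w n)) \<longlongrightarrow> 0) (along A)"
    "\<And>n j. j \<in> J \<Longrightarrow> filterlim (\<lambda>i. p m (S j i (w n))) at_top (along (H n))"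
    "\<And>n n' j. j \<in> J \<Longrightarrow> n' \<noteq> n \<Longrightarrow> ((\<lambda>i. S j i (w n')) \<longlongrightarrow> 0) (along (H n))"
proof -
  obtain x L E G where
    humps: "\<And>k. hump x k (if k = 0 then 0 else L (k - 1)) (x k) (L k) (E k) (G k)"
    using ex_gliding_humps by blast
  define K where "K k = (if k = 0 then 0 else L (k - 1))" for k
  note h = humps[folded K_def, unfolded hump_def]
  have fin: "finite (E k)" "finite (G k)" for k
    using h[of k] by (auto intro: finite_subset)
  have "incseq L"
    using h[of "Suc _"] by (auto simp: K_def intro: incseq_SucI)
  then have L_le_K: "L k \<le> K l" if "k < l" for k l
    using that incseqD[of L k "l - 1"] by (auto simp: K_def)
  have quarter: "(1/4 :: real) ^ max k l \<le> (1/2) ^ k * (1/2) ^ l" for k l :: nat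
  proof -
    have "(1/4 :: real) ^ max k l = (1/2) ^ (max k l + max k l)"
      by (simp add: power_add flip: power_mult_distrib)
    also have "\<dots> \<le> (1/2) ^ (k + l)"
      by (intro power_decreasing) auto
    finally show ?thesis by (simp add: power_add)
  qed
  have later: "p k (S j i (x l)) \<le> (1/2) ^ k * (1/2) ^ l" if "i \<le> L k" "k < l" "j \<in> J" for i j k l
  proof -
    have "p k (S j i (x l)) \<le> p l (S j i (x l))"
      using that by (intro seminorm_mono) simp
    also have "\<dots> \<le> (1/4) ^ l"
      using h[of l] that L_le_K[of k l] by auto
    finally show ?thesis using quarter[of k l] that by (simp add: max_def)
  qed
  have E_small: "p k (S j i (x l)) \<le> (1/2) ^ k * (1/2) ^ l"
    if "i \<in> E k" "l \<noteq> k" "j \<in> J" for i j k l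
  proof (cases "l < k")
    case True
    then have "p k (S j i (x l)) \<le> (1/4) ^ k" using h[of k] that by blast
    then show ?thesis using quarter[of k l] True by (simp add: max_def)
  qed (use that h[of k] in \<open>auto intro!: later\<close>)
  have G_small: "p k (S j i (x l)) \<le> (1/2) ^ k * (1/2) ^ l" if "i \<in> G k" "j \<in> J" for i j k l
  proof (cases "l \<le> k")
    case True
    then have "p k (S j i (x l)) \<le> (1/4) ^ k" using h[of k] that by (cases "l = k") auto
    then show ?thesis using quarter[of k l] True by (simp add: max_def)
  qed (use that h[of k] in \<open>auto intro!: later\<close>)
  \<comment> \<open>a partition of the natural numbers into infinitely many infinite classes\<close>
  define I where "I n = {k. fst (prod_decode k) = n}" for n
  have inf_I: "infinite (I n)" for n
  proof -
    have "range (\<lambda>b. prod_encode (n, b)) \<subseteq> I n" by (auto simp: I_def)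
    moreover have "infinite (range (\<lambda>b. prod_encode (n, b)))"
      by (rule range_inj_infinite) (auto simp: inj_on_def)
    ultimately show ?thesis using finite_subset by blast
  qed
  have "p n (x l) \<le> (1/2) ^ l" if "n \<le> l" for n l
  proof -
    have "p n (x l) \<le> (1/4) ^ l"
      using seminorm_mono[OF that, of "x l"] h[of l] by auto
    also have "\<dots> \<le> (1/2) ^ l"
      by (rule power_mono) auto
    finally show ?thesis .
  qed
  then have "\<exists>w. (\<lambda>K. \<Sum>l\<in>I n \<inter> {..<K}. x l) \<longlonglongrightarrow> w" for n
    by (rule geometric_series_converges)
  then have "\<exists>w. \<forall>n. (\<lambda>K. \<Sum>l\<in>I n \<inter> {..<K}. x l) \<longlonglongrightarrow> w n"
    by (intro choice allI)
  then obtain w where w: "\<And>n. (\<lambda>K. \<Sum>l\<in>I n \<inter> {..<K}. x l) \<longlonglongrightarrow> w n"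
    by blast
  have off_blocks: "p k (S j i (w n) - (\<Sum>l\<in>I n \<inter> Q. S j i (x l))) \<le> 2 * (1/2) ^ k"
    if "j \<in> J" "finite Q" "\<And>l. l \<notin> Q \<Longrightarrow> p k (S j i (x l)) \<le> (1/2) ^ k * (1/2) ^ l" for n k i j Q
    using series_remove_terms_le[OF S[OF that(1)] w that(2,3)] by simp
  have blocks_vanish: "((\<lambda>i. S j i (w n)) \<longlongrightarrow> 0) (along (\<Union>k\<in>I'. F k))"
    if fin: "\<And>k. finite (F k)"
      and small: "\<And>k i. k \<in> I' \<Longrightarrow> i \<in> F k \<Longrightarrow> p k (S j i (w n)) \<le> 2 * (1/2) ^ k"
    for j n I' and F :: "nat \<Rightarrow> nat set"
    unfolding tendsto_seminorm_iff
  proof (intro allI impI)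
    fix r and e :: real assume "e > 0"
    obtain k0 :: nat where k0: "(1/2) ^ k0 < e / 2"
      using real_arch_pow_inv[of "e/2" "1/2"] \<open>e > 0\<close> by auto
    have "p r (S j i (w n) - 0) < e" if "k \<in> I'" "max r k0 \<le> k" "i \<in> F k" for k i
    proof -
      have "p r (S j i (w n)) \<le> p k (S j i (w n))"
        using that(2) by (intro seminorm_mono) simp
      also have "\<dots> \<le> 2 * (1/2) ^ k"
        by (rule small[OF that(1,3)])
      also have "\<dots> \<le> 2 * (1/2) ^ k0"
        using that(2) by (intro mult_left_mono power_decreasing) auto
      also have "\<dots> < e" using k0 by simp
      finally show ?thesis by simp
    qed
    then show "eventually (\<lambda>i. p r (S j i (w n) - 0) < e) (along (\<Union>k\<in>I'. F k))"
      by (rule eventually_along_UN_blocks[OF fin, of I' "max r k0"])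
  qed
  show ?thesis
  proof (rule that[where A = "\<Union>k\<in>UNIV. G k" and H = "\<lambda>n. \<Union>k\<in>I n. E k" and w = w])
    show "upper_density (\<Union>k\<in>UNIV. G k) = 1" "upper_density (\<Union>k\<in>I n. E k) = 1" for n
      by (rule upper_density_UN_blocks; use h inf_I in simp)+
    show "((\<lambda>i. S j i (w n)) \<longlongrightarrow> 0) (along (\<Union>k\<in>UNIV. G k))" if "j \<in> J" for j n
      using off_blocks[OF that, where Q = "{}"] G_small that
      by (intro blocks_vanish fin) auto
    show "((\<lambda>i. S j i (w n')) \<longlongrightarrow> 0) (along (\<Union>k\<in>I n. E k))" if "j \<in> J" "n' \<noteq> n" for j n n'
    proof (intro blocks_vanish fin)
      fix k i assume "k \<in> I n" "i \<in> E k"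
      moreover have "k \<notin> I n'" using \<open>k \<in> I n\<close> that by (simp add: I_def)
      ultimately show "p k (S j i (w n')) \<le> 2 * (1/2) ^ k"
        using off_blocks[OF that(1), where Q = "{k}" and k = k and i = i and n = n'] E_small that
        by simp
    qed
    show "filterlim (\<lambda>i. p m (S j i (w n))) at_top (along (\<Union>k\<in>I n. E k))" if j: "j \<in> J" for j n
      unfolding filterlim_at_top
    proof
      fix Z :: real
      obtain k0 :: nat where k0: "real k0 \<ge> Z + 2" using real_arch_simple by blast
      have "Z \<le> p m (S j i (w n))" if k: "k \<in> I n" "max m k0 \<le> k" "i \<in> E k" for k i
      proof -
        have "p m (S j i (w n) - S j i (x k)) \<le> p k (S j i (w n) - S j i (x k))"
          using that by (intro seminorm_mono) simp
        also have "\<dots> \<le> 2 * (1/2) ^ k"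
          using off_blocks[OF j, where Q = "{k}" and k = k and i = i and n = n] E_small k j
          by simp
        also have "\<dots> \<le> 2" by (simp add: power_le_one)
        finally have "p m (S j i (w n) - S j i (x k)) \<le> 2" .
        moreover have "real k \<le> p m (S j i (x k))" using h[of k] k j by blast
        ultimately show ?thesis
          using seminorm_diff_triangle[of m "S j i (w n)" "S j i (w n) - S j i (x k)"] k k0
          by simp
      qed
      then show "eventually (\<lambda>i. Z \<le> p m (S j i (w n))) (along (\<Union>k\<in>I n. E k))"
        by (rule eventually_along_UN_blocks[OF fin(1), of "I n" "max m k0"])
    qed
  qed
qed

section \<open>A dense subspace of irregular vectors\<close>

text \<open>The summand from \<open>X0\<close> does not change the behaviour of the orbits, so it can be used to steer
  the family close to a dense sequence \<open>u\<close>.\<close>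

lemma dense_irregular_family:
  assumes "separable_space (euclidean :: 'a topology)"
  obtains v :: "nat \<Rightarrow> 'a" and A and H :: "nat \<Rightarrow> nat set" where
    "closure (range v) = UNIV" "upper_density A = 1" "\<And>n. upper_density (H n) = 1"
    "\<And>n j. j \<in> J \<Longrightarrow> ((\<lambda>i. S j i (v n)) \<longlongrightarrow> 0) (along A)"
    "\<And>n j. j \<in> J \<Longrightarrow> filterlim (\<lambda>i. p m (S j i (v n))) at_top (along (H n))"
    "\<And>n n' j. j \<in> J \<Longrightarrow> n' \<noteq> n \<Longrightarrow> ((\<lambda>i. S j i (v n')) \<longlongrightarrow> 0) (along (H n))"
proof -
  obtain w :: "nat \<Rightarrow> 'a" and A and H :: "nat \<Rightarrow> nat set" where w:
    "upper_density A = 1" "\<And>n. upper_density (H n) = 1"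
    "\<And>n j. j \<in> J \<Longrightarrow> ((\<lambda>i. S j i (w n)) \<longlongrightarrow> 0) (along A)"
    "\<And>n j. j \<in> J \<Longrightarrow> filterlim (\<lambda>i. p m (S j i (w n))) at_top (along (H n))"
    "\<And>n n' j. j \<in> J \<Longrightarrow> n' \<noteq> n \<Longrightarrow> ((\<lambda>i. S j i (w n')) \<longlongrightarrow> 0) (along (H n))"
    by (rule irregular_family) blast
  obtain u :: "nat \<Rightarrow> 'a" where u: "closure (range u) = UNIV"
    using separable_dense_sequence[OF assms] by blast
  \<comment> \<open>each \<open>u a\<close> occurs infinitely often in \<open>u'\<close>, so that it is approached with arbitrarily small error
    and with respect to every seminorm\<close>
  define u' where "u' n = u (fst (prod_decode n))" for n
  have "\<exists>y\<in>X0. p n (y - u' n) < 1 / real (Suc n)" for n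
    using dense_X0 closure_seminorm_iff[of "u' n" X0] by simp
  then obtain y where y: "\<And>n. y n \<in> X0" "\<And>n. p n (y n - u' n) < 1 / real (Suc n)"
    by metis
  have "\<exists>t. t \<noteq> 0 \<and> p n (smul t (w n)) < 1 / real (Suc n)" for n
    using small_multiple[of "1 / real (Suc n)" n "w n"] by simp
  then obtain t where t: "\<And>n. t n \<noteq> 0" "\<And>n. p n (smul (t n) (w n)) < 1 / real (Suc n)"
    by metis
  define v where "v n = y n + smul (t n) (w n)" for n
  have Sv: "S j i (v n) = S j i (y n) + smul (t n) (S j i (w n))" if "j \<in> J" for j i n
    by (simp add: v_def continuous_linear_operatorD[OF S[OF that]])
  have y_null: "((\<lambda>i. S j i (y n)) \<longlongrightarrow> 0) (along Q)" if "j \<in> J" for j n Q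
    using vanishing[OF y(1) that] by (rule tendsto_mono[rotated]) simp
  show ?thesis
  proof (rule that[where v = v and A = A and H = H])
    show "closure (range v) = UNIV"
    proof (intro set_eqI iffI UNIV_I)
      fix x
      show "x \<in> closure (range v)"
        unfolding closure_seminorm_iff
      proof (intro allI impI)
        fix r and e :: real assume e: "e > 0"
        have "\<exists>y\<in>range u. p r (y - x) < e / 2"
          using u closure_seminorm_iff[of x "range u"] half_gt_zero[OF e] by blast
        then obtain a where a: "p r (u a - x) < e / 2" by blast
        obtain b where b: "1 / real (Suc b) < e / 4"
          using nat_approx_posE[of "e / 4"] e by auto
        define n where "n = prod_encode (a, max r b)"
        have n: "r \<le> n" "b \<le> n" "u' n = u a"
          using le_prod_encode_2[of "max r b" a] by (auto simp: n_def u'_def)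
        have "p n (v n - u' n) \<le> p n (y n - u' n) + p n (smul (t n) (w n))"
          using seminorm_triangle[of n "y n - u' n" "smul (t n) (w n)"]
          by (simp add: v_def algebra_simps)
        also have "\<dots> < 2 / real (Suc n)"
          using y(2)[of n] t(2)[of n] by simp
        also have "\<dots> \<le> 2 / real (Suc b)"
          using n by (intro divide_left_mono) auto
        also have "\<dots> < e / 2" using b by simp
        finally have "p r (v n - u a) < e / 2"
          using seminorm_mono[OF n(1), of "v n - u a"] n(3) by simp
        then have "p r (v n - x) < e"
          using a seminorm_triangle[of r "v n - u a" "u a - x"] by simp
        then show "\<exists>y\<in>range v. p r (y - x) < e" by blast
      qed
    qed
    show "((\<lambda>i. S j i (v n)) \<longlongrightarrow> 0) (along A)" if "j \<in> J" for j n
      unfolding Sv[OF that] by (intro tendsto_zero_add_scale y_null w(3) that)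
    show "filterlim (\<lambda>i. p m (S j i (v n))) at_top (along (H n))" if "j \<in> J" for j n
      unfolding Sv[OF that] by (intro seminorm_at_top_add_null y_null w(4) t(1) that)
    show "((\<lambda>i. S j i (v n')) \<longlongrightarrow> 0) (along (H n))" if "j \<in> J" "n' \<noteq> n" for j n n'
      unfolding Sv[OF that(1)] by (intro tendsto_zero_add_scale y_null w(5) that)
  qed (rule w)+
qed

text \<open>All combinations vanish along the same set \<open>A\<close>, whereas the set along which a combination is
  unbounded depends on which of its coefficients is nonzero.\<close>

lemma dense_irregular_subspace:
  assumes "separable_space (euclidean :: 'a topology)"
  obtains V where "subspace V" "closure V = UNIV"
    "\<And>x. x \<in> V - {0} \<Longrightarrow>
      \<exists>A. upper_density A = 1 \<and> (\<forall>j\<in>J. ((\<lambda>i. S j i x) \<longlongrightarrow> 0) (along A))"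
    "\<And>x. x \<in> V - {0} \<Longrightarrow>
      \<exists>H. upper_density H = 1 \<and> (\<forall>j\<in>J. filterlim (\<lambda>i. p m (S j i x)) at_top (along H))"
proof -
  obtain v :: "nat \<Rightarrow> 'a" and A and H :: "nat \<Rightarrow> nat set" where v:
    "closure (range v) = UNIV" "upper_density A = 1"
    "\<And>n. upper_density (H n) = 1"
    "\<And>n j. j \<in> J \<Longrightarrow> ((\<lambda>i. S j i (v n)) \<longlongrightarrow> 0) (along A)"
    "\<And>n j. j \<in> J \<Longrightarrow> filterlim (\<lambda>i. p m (S j i (v n))) at_top (along (H n))"
    "\<And>n n' j. j \<in> J \<Longrightarrow> n' \<noteq> n \<Longrightarrow> ((\<lambda>i. S j i (v n')) \<longlongrightarrow> 0) (along (H n))"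
    using dense_irregular_family[OF assms] by blast
  have "closure (range v) \<subseteq> closure (span (range v))"
    by (intro closure_mono span_superset)
  then have dense: "closure (span (range v)) = UNIV" using v(1) by blast
  show ?thesis
  proof (rule that[OF subspace_span dense])
    fix x assume "x \<in> span (range v) - {0}"
    then obtain F c n where F: "finite F" and x: "x = (\<Sum>l\<in>F. smul (c l) (v l))"
      and n: "n \<in> F" "c n \<noteq> 0"
      using span_range_combination[of x v] by auto
    have Sx: "S j i x = (\<Sum>l\<in>F. smul (c l) (S j i (v l)))" if "j \<in> J" for j i
      by (simp add: x continuous_linear_operatorD[OF S[OF that]])
    show "\<exists>A. upper_density A = 1 \<and> (\<forall>j\<in>J. ((\<lambda>i. S j i x) \<longlongrightarrow> 0) (along A))"
      using v(2,4) by (intro exI[of _ A]) (simp add: Sx tendsto_zero_combination)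
    have "filterlim (\<lambda>i. p m (S j i x)) at_top (along (H n))" if j: "j \<in> J" for j
    proof -
      have "filterlim (\<lambda>i. p m ((\<Sum>l\<in>F - {n}. smul (c l) (S j i (v l))) + smul (c n) (S j i (v n))))
          at_top (along (H n))"
        using v(5,6) j n by (intro seminorm_at_top_add_null tendsto_zero_combination) auto
      then show ?thesis
        using F n by (simp add: Sx[OF j] sum.remove[of F n] add.commute)
    qed
    then show "\<exists>H. upper_density H = 1 \<and>
        (\<forall>j\<in>J. filterlim (\<lambda>i. p m (S j i x)) at_top (along H))"
      using v(3) by blast
  qed
qed

end

section \<open>Distributional chaos\<close>

context frechet_space
begin

lemma summable_metric_terms: "summable (\<lambda>n. (1/2) ^ Suc n * (p n z / (1 + p n z)))"
proof (rule summable_comparison_test')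
  show "summable (\<lambda>n. (1/2 :: real) ^ Suc n)"
    using power_half_series by (rule sums_summable)
  fix n :: nat
  have "\<bar>p n z / (1 + p n z)\<bar> \<le> 1"
    using seminorm_nonneg[of n z] by (simp del: seminorm_nonneg)
  then show "norm ((1/2) ^ Suc n * (p n z / (1 + p n z))) \<le> (1/2) ^ Suc n"
    using mult_left_mono[of "\<bar>p n z / (1 + p n z)\<bar>" 1 "(1/2) ^ Suc n"]
    by (simp only: real_norm_def abs_mult) simp
qed

lemma standard_metric_bounded_below:
  assumes "standard_metric p d"
  shows "\<exists>\<sigma>>0. \<forall>x y. 1 \<le> p m (x - y) \<longrightarrow> \<sigma> \<le> d x y"
  using assms unfolding standard_metric_def
proof
  assume d: "d = (\<lambda>x y. \<Sum>n. (1/2) ^ Suc n * (p n (x - y) / (1 + p n (x - y))))"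
  have "(1/2) ^ Suc m / 2 \<le> d x y" if "1 \<le> p m (x - y)" for x y
  proof -
    have "1 / 2 \<le> p m (x - y) / (1 + p m (x - y))"
      using that by (simp add: field_simps)
    then have "(1/2) ^ Suc m * (1 / 2) \<le> (1/2) ^ Suc m * (p m (x - y) / (1 + p m (x - y)))"
      by (rule mult_left_mono) simp
    also have "\<dots> \<le> d x y"
      using sum_le_suminf[OF summable_metric_terms, of "{m}" "x - y"] by (simp add: d)
    finally show ?thesis by simp
  qed
  then show ?thesis by (intro exI[of _ "(1/2) ^ Suc m / 2"]) auto
next
  assume "\<exists>nrm. p = (\<lambda>_. nrm) \<and> d = (\<lambda>x y. nrm (x - y))"
  then show ?thesis by (intro exI[of _ 1]) auto
qed

text \<open>For the metric given by the seminorms, all terms from the \<open>n\<close>-th on contribute at most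
  \<open>(1/2) ^ n\<close>, and the earlier ones at most \<open>p n (x - y)\<close>, since the seminorms increase.\<close>

lemma standard_metric_small:
  assumes "standard_metric p d" and \<epsilon>: "\<epsilon> > 0"
  shows "\<exists>n. \<exists>\<delta>>0. \<forall>x y. p n (x - y) < \<delta> \<longrightarrow> d x y < \<epsilon>"
  using assms(1) unfolding standard_metric_def
proof
  assume d: "d = (\<lambda>x y. \<Sum>n. (1/2) ^ Suc n * (p n (x - y) / (1 + p n (x - y))))"
  obtain n :: nat where n: "(1/2) ^ n < \<epsilon> / 2"
    using real_arch_pow_inv[of "\<epsilon>/2" "1/2"] \<epsilon> by auto
  have "d x y < \<epsilon>" if "p n (x - y) < \<epsilon> / 2" for x y
  proof -
    define f where "f k = (1/2) ^ Suc k * (p k (x - y) / (1 + p k (x - y)))" for k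
    have frac: "p k z / (1 + p k z) \<le> 1" "p k z / (1 + p k z) \<le> p k z" for k z
    proof -
      have "p k z * 1 \<le> p k z * (1 + p k z)"
        by (intro mult_left_mono) auto
      moreover have "0 < 1 + p k z"
        by (rule add_pos_nonneg) auto
      ultimately show "p k z / (1 + p k z) \<le> 1" "p k z / (1 + p k z) \<le> p k z"
        by (simp_all add: divide_le_eq)
    qed
    have geom: "(\<lambda>k. (1/2 :: real) ^ Suc k) sums 1"
      by (rule power_half_series)
    have f: "summable f" unfolding f_def by (rule summable_metric_terms)
    have "(\<Sum>k<n. f k) \<le> (\<Sum>k<n. (1/2) ^ Suc k * p n (x - y))"
      unfolding f_def
      by (intro sum_mono mult_left_mono order.trans[OF frac(2)] seminorm_mono) auto
    also have "\<dots> = (\<Sum>k<n. (1/2) ^ Suc k) * p n (x - y)"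
      by (rule sum_distrib_right[symmetric])
    also have "\<dots> \<le> 1 * p n (x - y)"
      using sum_le_suminf[OF sums_summable[OF geom], of "{..<n}"] sums_unique[OF geom]
      by (intro mult_right_mono) auto
    finally have head: "(\<Sum>k<n. f k) \<le> p n (x - y)" by simp
    have shift: "(\<lambda>k. (1/2) ^ n * (1/2 :: real) ^ Suc k) sums ((1/2) ^ n * 1)"
      using geom by (rule sums_mult)
    have "(\<Sum>k. f (k + n)) \<le> (\<Sum>k. (1/2) ^ n * (1/2 :: real) ^ Suc k)"
    proof (rule suminf_le)
      fix k
      have "f (k + n) \<le> (1/2) ^ Suc (k + n) * 1"
        unfolding f_def by (intro mult_left_mono frac) auto
      then show "f (k + n) \<le> (1/2) ^ n * (1/2) ^ Suc k"
        by (simp add: power_add mult_ac)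
    qed (use f summable_iff_shift[of f n] sums_summable[OF shift] in auto)
    also have "\<dots> = (1/2) ^ n" using sums_unique[OF shift] by simp
    finally have "(\<Sum>k. f (k + n)) + (\<Sum>k<n. f k) < \<epsilon>"
      using head n that by linarith
    moreover have "d x y = (\<Sum>k. f (k + n)) + (\<Sum>k<n. f k)"
      using suminf_split_initial_segment[OF f, of n] unfolding d f_def .
    ultimately show ?thesis by simp
  qed
  then show ?thesis using \<epsilon> by (intro exI[of _ n] exI[of _ "\<epsilon>/2"]) auto
next
  assume "\<exists>nrm. p = (\<lambda>_. nrm) \<and> d = (\<lambda>x y. nrm (x - y))"
  then show ?thesis using \<epsilon> by (intro exI[of _ 0] exI[of _ \<epsilon>]) auto
qed

lemma closed_linear_operator_funpow_diff:
  assumes T: "closed_linear_operator smul D T" and x: "x \<in> D_infinity D T" and y: "y \<in> D_infinity D T"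
  shows "(T ^^ k) (x - y) = (T ^^ k) x - (T ^^ k) y"
proof (induction k)
  case (Suc k)
  have "(T ^^ k) x \<in> D" "(T ^^ k) y \<in> D"
    using x y unfolding D_infinity_def by (auto dest: spec[of _ "Suc k"])
  moreover have "smul (- 1) ((T ^^ k) y) \<in> D"
    using T \<open>(T ^^ k) y \<in> D\<close> subspace_scale unfolding closed_linear_operator_def by blast
  ultimately have "T ((T ^^ k) x + smul (- 1) ((T ^^ k) y)) = T ((T ^^ k) x) + smul (- 1) (T ((T ^^ k) y))"
    using T by (simp only: closed_linear_operator_def)
  then show ?case using Suc by simp
qed simp

text \<open>For distinct \<open>x\<close> and \<open>y\<close> in \<open>W\<close>, irregularity of the single vector \<open>x - y\<close> describes the
  distances between the two orbits, because \<open>d\<close> is translation invariant. The separation \<open>\<sigma>\<close> can be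
  chosen for all pairs at once since the manifold is irregular with one seminorm \<open>p m\<close>.\<close>

lemma irregular_manifold_scrambled:
  assumes d: "standard_metric p d"
    and W: "uniformly_irregular_manifold smul p N D T W"
    and W_D: "W \<subseteq> (\<Inter>j\<in>{1..N}. D_infinity (D j) (T j))"
    and T: "\<And>j. j \<in> {1..N} \<Longrightarrow> closed_linear_operator smul (D j) (T j)"
  shows "distributionally_scrambled d N D T W"
proof -
  have sub: "subspace W" and "W \<noteq> {0}"
    using W by (auto simp: uniformly_irregular_manifold_def)
  then obtain z where "z \<in> W" "z \<noteq> 0"
    using subspace_0[of W] by blast
  obtain m where
    null: "\<And>x. x \<in> W \<Longrightarrow> x \<noteq> 0 \<Longrightarrow> \<exists>A. upper_density A = 1 \<and>
      (\<forall>j\<in>{1..N}. ((\<lambda>k. (T j ^^ k) x) \<longlongrightarrow> 0) (along A))"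
    and unbdd: "\<And>x. x \<in> W \<Longrightarrow> x \<noteq> 0 \<Longrightarrow> \<exists>B. upper_density B = 1 \<and>
      (\<forall>j\<in>{1..N}. filterlim (\<lambda>k. p m ((T j ^^ k) x)) at_top (along B))"
  proof -
    have "W \<inter> (\<Inter>j\<in>{1..N}. D_infinity (D j) (T j)) = W" using W_D by blast
    then obtain m where "\<forall>x\<in>W - {0}.
        (\<exists>A. upper_density A = 1 \<and> (\<forall>j\<in>{1..N}. ((\<lambda>k. (T j ^^ k) x) \<longlongrightarrow> 0) (along A))) \<and>
        (\<exists>B. upper_density B = 1 \<and>
           (\<forall>j\<in>{1..N}. filterlim (\<lambda>k. p m ((T j ^^ k) x)) at_top (along B)))"
      using W by (auto simp only: uniformly_irregular_manifold_def)
    then show ?thesis by (intro that[of m]) blast+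
  qed
  obtain \<sigma> where \<sigma>: "\<sigma> > 0" "\<And>x y. 1 \<le> p m (x - y) \<Longrightarrow> \<sigma> \<le> d x y"
    using standard_metric_bounded_below[OF d, of m] by blast
  have "upper_density (\<Inter>j\<in>{1..N}. {k. d ((T j ^^ k) x) ((T j ^^ k) y) \<ge> \<sigma>}) = 1 \<and>
      upper_density (\<Inter>j\<in>{1..N}. {k. d ((T j ^^ k) x) ((T j ^^ k) y) < \<epsilon>}) = 1"
    if \<epsilon>: "\<epsilon> > 0" and xy: "x \<in> W" "y \<in> W" "x \<noteq> y" for \<epsilon> x y
  proof
    have diff: "(T j ^^ k) (x - y) = (T j ^^ k) x - (T j ^^ k) y" if "j \<in> {1..N}" for j k
      using closed_linear_operator_funpow_diff[OF T[OF that]] W_D xy that by blast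
    have z: "x - y \<in> W" "x - y \<noteq> 0"
      using subspace_diff[OF sub] xy by auto
    obtain B where B: "upper_density B = 1"
      "\<And>j. j \<in> {1..N} \<Longrightarrow> filterlim (\<lambda>k. p m ((T j ^^ k) (x - y))) at_top (along B)"
      using unbdd[OF z] by blast
    have "eventually (\<lambda>k. d ((T j ^^ k) x) ((T j ^^ k) y) \<ge> \<sigma>) (along B)" if j: "j \<in> {1..N}" for j
    proof -
      have "eventually (\<lambda>k. 1 \<le> p m ((T j ^^ k) (x - y))) (along B)"
        using B(2)[OF j] unfolding filterlim_at_top by blast
      then show ?thesis
        by (rule eventually_mono) (simp add: diff[OF j] \<sigma>(2))
    qed
    then have "eventually (\<lambda>k. \<forall>j\<in>{1..N}. d ((T j ^^ k) x) ((T j ^^ k) y) \<ge> \<sigma>) (along B)"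
      by (simp add: eventually_ball_finite)
    from upper_density_1_mono_along[OF B(1) this]
    show "upper_density (\<Inter>j\<in>{1..N}. {k. d ((T j ^^ k) x) ((T j ^^ k) y) \<ge> \<sigma>}) = 1"
      by (simp add: INTER_eq)
    obtain n \<delta> where \<delta>: "\<delta> > 0" "\<And>x y. p n (x - y) < \<delta> \<Longrightarrow> d x y < \<epsilon>"
      using standard_metric_small[OF d \<epsilon>] by blast
    obtain A where A: "upper_density A = 1"
      "\<And>j. j \<in> {1..N} \<Longrightarrow> ((\<lambda>k. (T j ^^ k) (x - y)) \<longlongrightarrow> 0) (along A)"
      using null[OF z] by blast
    have "eventually (\<lambda>k. d ((T j ^^ k) x) ((T j ^^ k) y) < \<epsilon>) (along A)" if j: "j \<in> {1..N}" for j
    proof -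
      have "eventually (\<lambda>k. p n ((T j ^^ k) (x - y) - 0) < \<delta>) (along A)"
        using A(2)[OF j] \<delta>(1) unfolding tendsto_seminorm_iff by blast
      then show ?thesis
        by (rule eventually_mono) (simp add: diff[OF j] \<delta>(2))
    qed
    then have "eventually (\<lambda>k. \<forall>j\<in>{1..N}. d ((T j ^^ k) x) ((T j ^^ k) y) < \<epsilon>) (along A)"
      by (simp add: eventually_ball_finite)
    from upper_density_1_mono_along[OF A(1) this]
    show "upper_density (\<Inter>j\<in>{1..N}. {k. d ((T j ^^ k) x) ((T j ^^ k) y) < \<epsilon>}) = 1"
      by (simp add: INTER_eq)
  qed
  then show ?thesis
    unfolding distributionally_scrambled_def
    using uncountable_subspace[OF sub \<open>z \<in> W\<close> \<open>z \<noteq> 0\<close>] W_D \<sigma>(1) by blast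
qed

end

theorem corollary4p4:
  fixes smul :: "'k::real_or_complex_field \<Rightarrow> 'a::{ab_group_add, topological_space} \<Rightarrow> 'a"
    and p :: "nat \<Rightarrow> 'a \<Rightarrow> real"
    and d :: "'a \<Rightarrow> 'a \<Rightarrow> real"
    and N :: nat
    and D :: "nat \<Rightarrow> 'a set"
    and T :: "nat \<Rightarrow> 'a \<Rightarrow> 'a"
    and C :: "'a \<Rightarrow> 'a"
    and X0 :: "'a set"
  assumes "frechet_space smul p"
    and "standard_metric p d"
    and "\<exists>x::'a. x \<noteq> 0"
    and "separable_space (euclidean :: 'a topology)"
    and "N \<ge> 2"
    and "module.subspace smul X0" and "closure X0 = UNIV"
    and "\<And>j. j \<in> {1..N} \<Longrightarrow> closed_linear_operator smul (D j) (T j)"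
    and "continuous_linear_operator smul C" and "inj C"
    and "\<And>j. j \<in> {1..N} \<Longrightarrow> range C \<subseteq> D_infinity (D j) (T j)"
    and "\<And>j k. j \<in> {1..N} \<Longrightarrow> continuous_linear_operator smul (\<lambda>x. (T j ^^ k) (C x))"
    and a: "\<And>x j. x \<in> X0 \<Longrightarrow> j \<in> {1..N} \<Longrightarrow> (\<lambda>k. (T j ^^ k) (C x)) \<longlonglongrightarrow> 0"
    and b: "\<exists>x m B. upper_density B = 1 \<and>
              (\<forall>j\<in>{1..N}. filterlim (\<lambda>k. p m ((T j ^^ k) (C x))) at_top (along B))"
  shows "(\<exists>W. uniformly_irregular_manifold smul p N D T W) \<and>
         distributionally_chaotic d N D T \<and>
         (closure (range C) = UNIV \<longrightarrow>
            (\<exists>W. uniformly_irregular_manifold smul p N D T W \<and> closure W = UNIV) \<and>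
            densely_distributionally_chaotic d N D T)"
proof -
  interpret frechet_space smul p by fact
  obtain x0 m B where B: "upper_density B = 1"
    "\<And>j. j \<in> {1..N} \<Longrightarrow> filterlim (\<lambda>k. p m ((T j ^^ k) (C x0))) at_top (along B)"
    using b by blast
  interpret vanishing_unbounded_orbits smul p "{1..N}" "\<lambda>j k x. (T j ^^ k) (C x)" X0 x0 m B
    by unfold_locales (use assms B in auto)
  obtain V where V: "subspace V" "closure V = UNIV"
    and null: "\<And>u. u \<in> V - {0} \<Longrightarrow> \<exists>A. upper_density A = 1 \<and>
      (\<forall>j\<in>{1..N}. ((\<lambda>k. (T j ^^ k) (C u)) \<longlongrightarrow> 0) (along A))"
    and unbdd: "\<And>u. u \<in> V - {0} \<Longrightarrow> \<exists>H. upper_density H = 1 \<and>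
      (\<forall>j\<in>{1..N}. filterlim (\<lambda>k. p m ((T j ^^ k) (C u))) at_top (along H))"
    using dense_irregular_subspace[OF assms(4)] by blast
  note C = continuous_linear_operatorD[OF assms(9)]
  define W where "W = C ` V"
  have sub: "subspace W"
    using V(1) unfolding W_def subspace_def
    by (auto simp flip: C(1,2) intro!: imageI rev_image_eqI[where f = C and x = 0] simp: C(3))
  have W_nonzero: "\<exists>u\<in>V - {0}. x = C u" if "x \<in> W" "x \<noteq> 0" for x
    using that C(3) by (auto simp: W_def)
  have "V \<noteq> {0}"
  proof
    assume "V = {0}"
    obtain x :: 'a where "x \<noteq> 0" using assms(3) by blast
    then obtain n where "p n x \<noteq> 0" using separating by blast
    then have "p n x > 0" using seminorm_nonneg[of n x] by linarith
    moreover have "x \<in> closure {0}" using V(2) \<open>V = {0}\<close> by simp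
    ultimately show False
      unfolding closure_seminorm_iff by fastforce
  qed
  then obtain u where "u \<in> V" "u \<noteq> 0" using subspace_0[OF V(1)] by blast
  then have "C u \<in> W" "C u \<noteq> 0"
    using \<open>inj C\<close> C(3) by (auto simp: W_def dest: injD[of C u 0])
  then have "W \<noteq> {0}" by blast
  have manifold: "uniformly_irregular_manifold smul p N D T W"
    unfolding uniformly_irregular_manifold_def
  proof (intro conjI exI[of _ m] ballI)
    fix x assume "x \<in> W \<inter> (\<Inter>j\<in>{1..N}. D_infinity (D j) (T j)) - {0}"
    then obtain u where u: "u \<in> V - {0}" "x = C u" using W_nonzero by blast
    show "\<exists>A. upper_density A = 1 \<and> (\<forall>j\<in>{1..N}. ((\<lambda>k. (T j ^^ k) x) \<longlongrightarrow> 0) (along A))"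
      using null[OF u(1)] u(2) by simp
    show "\<exists>B. upper_density B = 1 \<and>
        (\<forall>j\<in>{1..N}. filterlim (\<lambda>k. p m ((T j ^^ k) x)) at_top (along B))"
      using unbdd[OF u(1)] u(2) by simp
  qed fact+
  have scrambled: "distributionally_scrambled d N D T W"
  proof (rule irregular_manifold_scrambled[OF assms(2) manifold _ assms(8)])
    show "W \<subseteq> (\<Inter>j\<in>{1..N}. D_infinity (D j) (T j))"
      using assms(11) unfolding W_def by blast
  qed
  have dense: "closure W = UNIV" if "closure (range C) = UNIV"
  proof -
    have "C ` closure V \<subseteq> closure (C ` V)"
      using assms(9) V(2)
      by (intro image_closure_subset closed_closure closure_subset)
        (simp add: continuous_linear_operator_def)
    then have "closure (range C) \<subseteq> closure W"
      using V(2) by (intro closure_minimal) (auto simp: W_def)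
    then show ?thesis using that by blast
  qed
  show ?thesis
    using manifold scrambled dense
    unfolding distributionally_chaotic_def densely_distributionally_chaotic_def by blast
qed

end
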